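(* Let $d\geq 3$ be a fixed integer. For the $d$-ary caterpillar $F^d_n$ with $n$ leaves (where $n=1+h(d-1)$ for some integer $h\geq 1$), the number $N(F^d_n)$ of nonisomorphic leaf-induced subtrees is $$N(F^d_n)=\frac{(d-1)^{\frac{n+d-2}{d-1}}-1}{d-2}.$$
   Context: A topological tree is a (finite) rooted tree with no vertex of outdegree $1$ (the one-vertex tree is a topological tree). Leaves are the vertices of outdegree $0$; the other vertices are internal vertices. Leaf-induced subtrees: let $T$ be a topological tree and $S$ a nonempty subset of its leaves. The subtree induced by $S$ is obtained as follows: (1) take the most recent common ancestor of the leaves in $S$ and all vertices and edges on the paths connecting it to the leaves in $S$, giving a tree rooted at that common ancestor; (2) contract every vertex of outdegree $1$ in this tree (if $g$ has outdegree $1$ and neighbours $f$ and $h$, delete $g$ and add the edge $\{f,h\}$). The result is again a topological tree; a single leaf induces the one-vertex tree. Isomorphism means isomorphism of rooted trees (root-preserving, children unordered). $N(T)$ denotes the number of isomorphism classes of leaf-induced subtrees of $T$, over all nonempty subsets $S$ of leaves. The $d$-ary caterpillar $F^d_n$ is the rooted tree with $n$ leaves in which every vertex has outdegree $0$ or $d$ and whose internal vertices form a path starting at the root: every internal vertex has exactly $d-1$ leaf children and one internal child, except the deepest internal vertex, which has $d$ leaf children. If its height is $h$, then it has $h$ internal vertices and $n=1+h(d-1)$ leaves. *)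

theory Defs
  imports Complex_Main
begin

text \<open>Rooted trees are finite and unordered; the arcs are directed away from the root.\<close>

record 'v rtree =
  verts :: "'v set"
  arcs :: "('v \<times> 'v) set"
  root :: 'v

text \<open>Unique parents together with reachability from the parentless root exclude all cycles.\<close>

definition rooted_tree :: "'v rtree \<Rightarrow> bool" where
  "rooted_tree T \<longleftrightarrow>
     finite (verts T) \<and> root T \<in> verts T \<and> arcs T \<subseteq> verts T \<times> verts T \<and>
     (\<forall>u. (u, root T) \<notin> arcs T) \<and>
     (\<forall>u u' v. (u, v) \<in> arcs T \<longrightarrow> (u', v) \<in> arcs T \<longrightarrow> u = u') \<and>
     (\<forall>v\<in>verts T. (root T, v) \<in> (arcs T)\<^sup>*)"

definition children :: "'v rtree \<Rightarrow> 'v \<Rightarrow> 'v set" where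
  "children T v = arcs T `` {v}"

definition outdegree :: "'v rtree \<Rightarrow> 'v \<Rightarrow> nat" where
  "outdegree T v = card (children T v)"

definition leaves :: "'v rtree \<Rightarrow> 'v set" where
  "leaves T = {v \<in> verts T. outdegree T v = 0}"

definition internals :: "'v rtree \<Rightarrow> 'v set" where
  "internals T = verts T - leaves T"

definition topological_tree :: "'v rtree \<Rightarrow> bool" where
  "topological_tree T \<longleftrightarrow> rooted_tree T \<and> (\<forall>v\<in>verts T. outdegree T v \<noteq> 1)"

definition ancestor :: "'v rtree \<Rightarrow> 'v \<Rightarrow> 'v \<Rightarrow> bool" where
  "ancestor T u v \<longleftrightarrow> (u, v) \<in> (arcs T)\<^sup>*"

definition common_ancestor :: "'v rtree \<Rightarrow> 'v set \<Rightarrow> 'v \<Rightarrow> bool" where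
  "common_ancestor T S a \<longleftrightarrow> a \<in> verts T \<and> (\<forall>s\<in>S. ancestor T a s)"

definition mrca :: "'v rtree \<Rightarrow> 'v set \<Rightarrow> 'v" where
  "mrca T S = (THE a. common_ancestor T S a \<and> (\<forall>b. common_ancestor T S b \<longrightarrow> ancestor T b a))"

text \<open>The vertices on the path from a vertex down to one of its descendants are exactly those
  lying between the two in the ancestor order.\<close>

definition span_verts :: "'v rtree \<Rightarrow> 'v set \<Rightarrow> 'v set" where
  "span_verts T S = {v. ancestor T (mrca T S) v \<and> (\<exists>s\<in>S. ancestor T v s)}"

definition span_tree :: "'v rtree \<Rightarrow> 'v set \<Rightarrow> 'v rtree" where
  "span_tree T S =
     \<lparr>verts = span_verts T S, arcs = arcs T \<inter> span_verts T S \<times> span_verts T S, root = mrca T S\<rparr>"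

text \<open>Only a vertex with a parent is contracted. In a spanning tree this is no restriction:
  its root, the most recent common ancestor, never has outdegree 1.\<close>

inductive contract_step :: "'v rtree \<Rightarrow> 'v rtree \<Rightarrow> bool" where
  "g \<in> verts T \<Longrightarrow> (f, g) \<in> arcs T \<Longrightarrow> children T g = {h} \<Longrightarrow>
   contract_step T
     \<lparr>verts = verts T - {g}, arcs = insert (f, h) (arcs T - {(f, g), (g, h)}), root = root T\<rparr>"

definition induces :: "'v rtree \<Rightarrow> 'v set \<Rightarrow> 'v rtree \<Rightarrow> bool" where
  "induces T S T' \<longleftrightarrow>
     contract_step\<^sup>*\<^sup>* (span_tree T S) T' \<and> (\<forall>v\<in>verts T'. outdegree T' v \<noteq> 1)"

definition leaf_induced_subtrees :: "'v rtree \<Rightarrow> 'v rtree set" where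
  "leaf_induced_subtrees T = {T'. \<exists>S. S \<noteq> {} \<and> S \<subseteq> leaves T \<and> induces T S T'}"

definition rtree_iso :: "'v rtree \<Rightarrow> 'w rtree \<Rightarrow> bool" where
  "rtree_iso A B \<longleftrightarrow>
     (\<exists>\<phi>. bij_betw \<phi> (verts A) (verts B) \<and> \<phi> (root A) = root B \<and>
        (\<forall>u\<in>verts A. \<forall>v\<in>verts A. (u, v) \<in> arcs A \<longleftrightarrow> (\<phi> u, \<phi> v) \<in> arcs B))"

definition num_leaf_induced :: "'v rtree \<Rightarrow> nat" where
  "num_leaf_induced T = card (leaf_induced_subtrees T // {(A, B). rtree_iso A B})"

text \<open>A predicate that determines the tree up to isomorphism. In a rooted tree the parent of an
  internal vertex is internal, so the path \<open>xs\<close> carries all arcs between internal vertices;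
  hence every internal vertex but the last has one internal child and \<open>d - 1\<close> leaf children, and
  the last one has \<open>d\<close> leaf children.\<close>

definition caterpillar :: "nat \<Rightarrow> nat \<Rightarrow> 'v rtree \<Rightarrow> bool" where
  "caterpillar d n T \<longleftrightarrow>
     rooted_tree T \<and> card (leaves T) = n \<and> (\<forall>v\<in>verts T. outdegree T v \<in> {0, d}) \<and>
     (\<exists>xs. xs \<noteq> [] \<and> hd xs = root T \<and> distinct xs \<and> set xs = internals T \<and>
        successively (\<lambda>u v. (u, v) \<in> arcs T) xs)"

lemma caterpillar_topological_tree:
  assumes "caterpillar d n T" and "d \<ge> 2"
  shows "topological_tree T"
  using assms by (fastforce simp: caterpillar_def topological_tree_def)

text \<open>Caterpillars exist for every height \<open>h\<close>: the pairs \<open>(i, 0)\<close> form the spine.\<close>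

lemma caterpillar_exists:
  assumes d: "d \<ge> 2" and h: "h \<ge> 1"
  shows "\<exists>T :: (nat \<times> nat) rtree. caterpillar d (1 + h * (d - 1)) T"
proof -
  define V :: "(nat \<times> nat) set" where "V = insert (h, 0) ({..<h} \<times> {..<d})"
  define E :: "((nat \<times> nat) \<times> nat \<times> nat) set" where "E = {((i, 0), (Suc i, 0)) |i. i < h} \<union>
                      {((i, 0), (i, j)) |i j. i < h \<and> 0 < j \<and> j < d}"
  define T :: "(nat \<times> nat) rtree" where "T = \<lparr>verts = V, arcs = E, root = (0, 0)\<rparr>"
  have sel: "verts T = V" "arcs T = E" "root T = (0, 0)" by (simp_all add: T_def)
  have spine: "((0, 0), (i, 0)) \<in> E\<^sup>*" if "i \<le> h" for i
    using that
  proof (induction i)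
    case (Suc i)
    moreover have "((i, 0), (Suc i, 0)) \<in> E" using Suc.prems by (auto simp: E_def)
    ultimately show ?case by (meson Suc_leD rtrancl.rtrancl_into_rtrancl)
  qed simp
  have reach: "((0, 0), v) \<in> E\<^sup>*" if "v \<in> V" for v
  proof (cases v)
    case (Pair i j)
    show ?thesis
    proof (cases "j = 0")
      case True
      then show ?thesis using that Pair spine by (auto simp: V_def)
    next
      case False
      then have "((i, 0), (i, j)) \<in> E" "i \<le> h"
        using that Pair by (auto simp: V_def E_def)
      then show ?thesis using Pair spine by (meson rtrancl.rtrancl_into_rtrancl)
    qed
  qed
  have "finite V" by (simp add: V_def)
  moreover have "E \<subseteq> V \<times> V"
    using d by (auto simp: E_def V_def)
  moreover have "(0, 0) \<in> V" using d h by (auto simp: V_def)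
  ultimately have tree: "rooted_tree T"
    using reach by (auto simp: rooted_tree_def sel E_def)
  have ch: "children T (i, 0) = insert (Suc i, 0) ({i} \<times> {0<..<d})" if "i < h" for i
    using that by (auto simp: children_def sel E_def)
  have ch0: "children T (i, j) = {}" if "i \<ge> h \<or> j > 0" for i j
    using that by (auto simp: children_def sel E_def)
  have od: "outdegree T (i, 0) = d" if "i < h" for i
    using ch[OF that] d by (simp add: outdegree_def card_cartesian_product)
  have od0: "outdegree T (i, j) = 0" if "i \<ge> h \<or> j > 0" for i j
    using ch0[OF that] by (simp add: outdegree_def)
  have out: "outdegree T v = (if fst v < h \<and> snd v = 0 then d else 0)" for v
    using od od0 by (cases v) (auto simp: not_less)
  have lv: "leaves T = insert (h, 0) ({..<h} \<times> {0<..<d})"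
    using d by (auto simp: leaves_def out sel V_def split: if_splits)
  have int: "internals T = (\<lambda>i. (i, 0)) ` {..<h}"
    using d by (auto simp: internals_def lv sel V_def)
  define xs where "xs = map (\<lambda>i. (i, 0::nat)) [0..<h]"
  have "successively (\<lambda>u v. (u, v) \<in> arcs T) xs"
    unfolding xs_def sel E_def by (auto simp: successively_conv_nth)
  moreover have "xs \<noteq> []" "hd xs = root T" "distinct xs" "set xs = internals T"
    using h by (auto simp: xs_def sel hd_map int distinct_map inj_on_def)
  moreover have "card (leaves T) = 1 + h * (d - 1)"
    unfolding lv by (subst card_insert_disjoint) (auto simp: card_cartesian_product)
  ultimately show ?thesis
    using tree out unfolding caterpillar_def by (intro exI[of _ T]) auto
qed

end

theory Submission
  imports Defs
begin

text \<open>A rooted tree whose internal vertices form a path starting at the root is determined up to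
  isomorphism by the list of outdegrees along this path. Having at most one internal child per
  vertex is inherited by spanning trees and preserved by contraction, as are the upper bounds on the
  outdegrees and on the number of internal vertices. So every leaf-induced subtree of the caterpillar
  of height \<open>h\<close> is of this kind, and its list has length at most \<open>h\<close> and entries in \<open>{2..d}\<close>.
  Conversely every such list is realized by choosing leaves near the lower end of the caterpillar.
  There are \<open>(d - 1)\<^sup>i\<close> lists of length \<open>i\<close>, and the geometric sum over \<open>i \<le> h\<close> is the claimed
  value, since \<open>h + 1 = (n + d - 2) / (d - 1)\<close>.\<close>

section \<open>Ancestors in rooted trees\<close>

lemma rooted_tree_root_no_parent: "rooted_tree T \<Longrightarrow> (u, root T) \<notin> arcs T"
  by (simp add: rooted_tree_def)

lemma rooted_tree_parent_unique:
  "rooted_tree T \<Longrightarrow> (u, v) \<in> arcs T \<Longrightarrow> (u', v) \<in> arcs T \<Longrightarrow> u = u'"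
  unfolding rooted_tree_def by blast

lemma rooted_tree_arc_verts:
  "rooted_tree T \<Longrightarrow> (u, v) \<in> arcs T \<Longrightarrow> u \<in> verts T \<and> v \<in> verts T"
  unfolding rooted_tree_def by blast

lemma rooted_tree_reach: "rooted_tree T \<Longrightarrow> v \<in> verts T \<Longrightarrow> (root T, v) \<in> (arcs T)\<^sup>*"
  by (simp add: rooted_tree_def)

lemma finite_children: "rooted_tree T \<Longrightarrow> finite (children T v)"
  unfolding rooted_tree_def children_def
  by (rule finite_subset[of _ "verts T"]) auto

lemma mem_children [simp]: "w \<in> children T v \<longleftrightarrow> (v, w) \<in> arcs T"
  by (simp add: children_def)

lemma mem_internals: "rooted_tree T \<Longrightarrow> v \<in> internals T \<longleftrightarrow> children T v \<noteq> {}"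
  using finite_children[of T v] rooted_tree_arc_verts[of T v]
  by (auto simp: internals_def leaves_def outdegree_def)

lemma arc_internal: "rooted_tree T \<Longrightarrow> (u, v) \<in> arcs T \<Longrightarrow> u \<in> internals T"
  by (auto simp: mem_internals)

lemma finite_internals: "rooted_tree T \<Longrightarrow> finite (internals T)"
  by (simp add: internals_def rooted_tree_def)

text \<open>Induction along a path from the root: the root has no parent and so lies on no cycle,
  and a cycle through any other reached vertex would enter it through its only parent, which would
  then lie on a cycle too.\<close>

lemma rooted_tree_acyclic:
  assumes T: "rooted_tree T"
  shows "(v, v) \<notin> (arcs T)\<^sup>+"
proof
  assume cyc: "(v, v) \<in> (arcs T)\<^sup>+"
  then have "v \<in> verts T"
    by (metis T rooted_tree_arc_verts tranclD)
  then have "(root T, v) \<in> (arcs T)\<^sup>*"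
    by (rule rooted_tree_reach[OF T])
  then have "(v, v) \<notin> (arcs T)\<^sup>+"
  proof (induction rule: rtrancl_induct)
    case base
    then show ?case
      by (metis T rooted_tree_root_no_parent tranclD2)
  next
    case (step y z)
    then show ?case
      by (metis T rooted_tree_parent_unique rtrancl_into_trancl2 tranclD2)
  qed
  with cyc show False by simp
qed

lemma rooted_tree_antisym:
  assumes "rooted_tree T" "(u, v) \<in> (arcs T)\<^sup>*" "(v, u) \<in> (arcs T)\<^sup>*"
  shows "u = v"
  using assms rooted_tree_acyclic by (metis rtranclD trancl_rtrancl_trancl)

text \<open>Parents are unique, so the upward walk from \<open>s\<close> is deterministic and passes
  through both \<open>a\<close> and \<open>b\<close>.\<close>

lemma ancestors_comparable:
  assumes T: "rooted_tree T" and "(a, s) \<in> (arcs T)\<^sup>*" "(b, s) \<in> (arcs T)\<^sup>*"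
  shows "(a, b) \<in> (arcs T)\<^sup>* \<or> (b, a) \<in> (arcs T)\<^sup>*"
proof -
  have "single_valued ((arcs T)\<inverse>)"
    using rooted_tree_parent_unique[OF T] by (auto simp: single_valued_def)
  then show ?thesis
    using single_valued_confluent[of "(arcs T)\<inverse>" s a b] assms(2,3)
    by (auto simp: rtrancl_converse)
qed

lemma parent_exists:
  assumes "rooted_tree T" "v \<in> verts T" "v \<noteq> root T"
  obtains u where "(u, v) \<in> arcs T"
  using rooted_tree_reach[OF assms(1,2)] assms(3) by (metis rtranclE)

text \<open>A nontrivial path from \<open>c\<close> to \<open>c'\<close> would enter
  \<open>c'\<close> through its only parent \<open>v\<close>, closing a cycle through
  \<open>v\<close> and \<open>c\<close>.\<close>

lemma siblings_incomparable:
  assumes T: "rooted_tree T" and "(v, c) \<in> arcs T" "(v, c') \<in> arcs T" "(c, c') \<in> (arcs T)\<^sup>*"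
  shows "c = c'"
proof (rule ccontr)
  assume "c \<noteq> c'"
  then obtain z where "(c, z) \<in> (arcs T)\<^sup>*" "(z, c') \<in> arcs T"
    using assms(4) by (metis rtranclE)
  then have "(c, v) \<in> (arcs T)\<^sup>*"
    using rooted_tree_parent_unique[OF T] assms(3) by metis
  then have "(v, v) \<in> (arcs T)\<^sup>+"
    using assms(2) by (metis rtrancl_into_trancl2)
  with rooted_tree_acyclic[OF T] show False by blast
qed

lemma leaf_no_child: "rooted_tree T \<Longrightarrow> s \<in> leaves T \<Longrightarrow> (s, x) \<notin> arcs T"
  using arc_internal by (fastforce simp: internals_def)

lemma leaf_or_internal: "v \<in> verts T \<Longrightarrow> v \<in> leaves T \<or> v \<in> internals T"
  by (simp add: internals_def)

section \<open>Trees whose internal vertices form a path\<close>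

text \<open>The condition on the head is guarded so that the one-vertex tree, which has no internal
  vertex, has the empty list as its spine.\<close>

definition spine :: "'v rtree \<Rightarrow> 'v list \<Rightarrow> bool" where
  "spine T xs \<longleftrightarrow> rooted_tree T \<and> distinct xs \<and> set xs = internals T \<and>
     (xs \<noteq> [] \<longrightarrow> hd xs = root T) \<and> successively (\<lambda>u v. (u, v) \<in> arcs T) xs"

lemma spine_arc: "spine T xs \<Longrightarrow> Suc i < length xs \<Longrightarrow> (xs ! i, xs ! Suc i) \<in> arcs T"
  unfolding spine_def by (auto simp: successively_conv_nth)

lemma spine_nth_0: "spine T xs \<Longrightarrow> 0 < length xs \<Longrightarrow> xs ! 0 = root T"
  unfolding spine_def by (auto simp: hd_conv_nth)

lemma spine_internals_nth: "spine T xs \<Longrightarrow> v \<in> internals T \<longleftrightarrow> (\<exists>i<length xs. v = xs ! i)"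
  unfolding spine_def by (metis in_set_conv_nth)

text \<open>The child is some \<open>xs ! j\<close>. Here \<open>j\<close> is positive because the
  root has no parent, and the unique parent of \<open>xs ! j\<close> is its predecessor on the
  spine, so that predecessor is \<open>xs ! i\<close>.\<close>

lemma spine_internal_child:
  assumes sp: "spine T xs" and i: "i < length xs" and arc: "(xs ! i, v) \<in> arcs T"
    and v: "v \<in> internals T"
  shows "Suc i < length xs \<and> v = xs ! Suc i"
proof -
  have T: "rooted_tree T" and dist: "distinct xs" using sp by (auto simp: spine_def)
  obtain j where j: "j < length xs" "v = xs ! j"
    using v spine_internals_nth[OF sp] by blast
  have "j \<noteq> 0"
    using rooted_tree_root_no_parent[OF T] spine_nth_0[OF sp] arc j by (metis (no_types))
  then obtain k where k: "j = Suc k" using not0_implies_Suc by blast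
  have "xs ! k = xs ! i"
    using spine_arc[OF sp, of k] j k arc rooted_tree_parent_unique[OF T] by metis
  then have "k = i"
    using dist i j k by (simp add: nth_eq_iff_index_eq)
  then show ?thesis using j k by simp
qed

text \<open>Both lists start at the root, and by \<open>spine_internal_child\<close> the successor
  of an entry is forced. This makes the outdegree list along the spine an invariant of the
  tree.\<close>

lemma spine_unique:
  assumes xs: "spine T xs" and ys: "spine T ys"
  shows "xs = ys"
proof (rule nth_equalityI)
  show len: "length xs = length ys"
    using xs ys distinct_card unfolding spine_def by metis
  show "xs ! i = ys ! i" if "i < length xs" for i
    using that
  proof (induction i)
    case 0
    then show ?case using spine_nth_0[OF xs] spine_nth_0[OF ys] len by simp
  next
    case (Suc i)
    have "ys ! Suc i \<in> internals T"
      using ys Suc.prems len by (metis nth_mem spine_def)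
    then show ?case
      using spine_internal_child[OF xs, of i "ys ! Suc i"] spine_arc[OF ys, of i] Suc len by auto
  qed
qed

text \<open>A local, list-free form of having a spine, which is easy to carry through restriction
  and contraction. \<open>spine_imp_linear\<close> and \<open>spine_exists\<close> translate between
  the two.\<close>

definition internals_linear :: "'v rtree \<Rightarrow> bool" where
  "internals_linear T \<longleftrightarrow>
     (\<forall>u v w. (u, v) \<in> arcs T \<longrightarrow> (u, w) \<in> arcs T \<longrightarrow> v \<in> internals T \<longrightarrow> w \<in> internals T \<longrightarrow> v = w)"

lemma spine_imp_linear:
  assumes sp: "spine T xs"
  shows "internals_linear T"
  unfolding internals_linear_def
proof (intro allI impI)
  fix u v w
  assume arcs: "(u, v) \<in> arcs T" "(u, w) \<in> arcs T" and int: "v \<in> internals T" "w \<in> internals T"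
  have "u \<in> internals T" using sp arcs(1) arc_internal unfolding spine_def by metis
  then obtain i where "i < length xs" "u = xs ! i" using spine_internals_nth[OF sp] by blast
  then show "v = w"
    using spine_internal_child[OF sp, of i] arcs int by metis
qed

lemma ancestor_internal:
  assumes "rooted_tree T" "(u, v) \<in> (arcs T)\<^sup>*" "v \<in> internals T"
  shows "u \<in> internals T"
  using assms by (metis arc_internal converse_rtranclE)

text \<open>A path of internal vertices that starts at the root and misses some internal vertex can
  be prolonged at its end. Prolonging until the length is the number of internal vertices gives the
  spine.\<close>

lemma spine_exists:
  assumes T: "rooted_tree T" and lin: "internals_linear T"
  obtains xs where "spine T xs"
proof (cases "internals T = {}")
  case True
  then have "spine T []" using T by (simp add: spine_def)
  then show ?thesis by (rule that)
next
  case False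
  then have root: "root T \<in> internals T"
    using rooted_tree_reach[OF T] ancestor_internal[OF T] by (auto simp: internals_def)
  let ?P = "\<lambda>xs. xs \<noteq> [] \<and> distinct xs \<and> set xs \<subseteq> internals T \<and> hd xs = root T \<and>
      successively (\<lambda>u v. (u, v) \<in> arcs T) xs"
  have "\<exists>xs. ?P xs \<and> length xs = Suc k" if "Suc k \<le> card (internals T)" for k
    using that
  proof (induction k)
    case 0
    then show ?case using root by (intro exI[of _ "[root T]"]) simp
  next
    case (Suc k)
    then obtain xs where xs: "?P xs" "length xs = Suc k" by auto
    have "card (set xs) < card (internals T)"
      using Suc.prems xs by (simp add: distinct_card)
    then obtain v where v: "v \<in> internals T" "v \<notin> set xs"
      using xs by (metis nat_neq_iff subset_antisym subsetI)
    have "(root T, v) \<in> (arcs T)\<^sup>*"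
      using v rooted_tree_reach[OF T] by (simp add: internals_def)
    \<comment> \<open>The path from the root to the missed vertex \<open>v\<close> leaves
      \<open>set xs\<close> along some arc, and the vertex it enters is internal, being
      \<open>v\<close> or an ancestor of \<open>v\<close>.\<close>
    then have "v \<in> internals T \<Longrightarrow> v \<notin> set xs \<Longrightarrow>
        \<exists>u w. u \<in> set xs \<and> w \<notin> set xs \<and> (u, w) \<in> arcs T \<and> w \<in> internals T"
    proof (induction rule: rtrancl_induct)
      case base
      then show ?case using xs(1) hd_in_set by metis
    next
      case (step y z)
      then show ?case using arc_internal[OF T] by blast
    qed
    then obtain u w where uw: "u \<in> set xs" "w \<notin> set xs" "(u, w) \<in> arcs T" "w \<in> internals T"
      using v by blast
    \<comment> \<open>Any earlier entry already has its successor in \<open>xs\<close> as internal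
      child, so linearity would put \<open>w\<close> into \<open>xs\<close>.\<close>
    have "u = last xs"
    proof (rule ccontr)
      assume ne: "u \<noteq> last xs"
      obtain i where i: "i < length xs" "xs ! i = u"
        using uw(1) by (auto simp: in_set_conv_nth)
      have "Suc i < length xs"
        using ne i xs(1) by (metis Suc_lessI diff_Suc_1 last_conv_nth)
      moreover from this have "(u, xs ! Suc i) \<in> arcs T" "xs ! Suc i \<in> set xs"
        using xs(1) i by (auto simp: successively_conv_nth)
      ultimately show False
        using lin uw xs(1) unfolding internals_linear_def by (metis subsetD)
    qed
    then have "?P (xs @ [w]) \<and> length (xs @ [w]) = Suc (Suc k)"
      using xs uw by (auto simp: successively_append_iff)
    then show ?case by blast
  qed
  moreover have "card (internals T) \<noteq> 0"
    using False finite_internals[OF T] by simp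
  ultimately obtain xs where xs: "?P xs" "length xs = card (internals T)"
    by (metis not0_implies_Suc order_refl)
  then have "set xs = internals T"
    using finite_internals[OF T] by (metis card_subset_eq distinct_card)
  then have "spine T xs" using xs T by (simp add: spine_def)
  then show ?thesis by (rule that)
qed

section \<open>Isomorphism and outdegrees along the spine\<close>

text \<open>Allows the children of two corresponding spine vertices to be matched so that the next
  spine vertex goes to the next spine vertex.\<close>

lemma bij_betw_pointed:
  assumes "finite X" "finite Y" "card X = card Y" "x \<in> X" "y \<in> Y"
  obtains f where "bij_betw f X Y" "f x = y"
proof -
  have "card (X - {x}) = card (Y - {y})" using assms by simp
  then obtain g where g: "bij_betw g (X - {x}) (Y - {y})"
    using assms finite_same_card_bij[of "X - {x}" "Y - {y}"] by auto
  have "bij_betw (g(x := y)) (X - {x}) (Y - {y})"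
    using g by (subst bij_betw_cong[of _ _ g]) auto
  then have "bij_betw (g(x := y)) (X - {x} \<union> {x}) (Y - {y} \<union> {y})"
    using notIn_Un_bij_betw[of x "X - {x}" "g(x := y)" "Y - {y}"] by simp
  then have "bij_betw (g(x := y)) X Y"
    using assms by (simp add: insert_absorb)
  then show ?thesis by (rule that) simp
qed

text \<open>Corresponding spine vertices have equally many children. Every vertex other than the
  root is a child of exactly one spine vertex, so bijections between these child sets glue to one
  map of the trees.\<close>

lemma equal_outdegrees_imp_iso:
  assumes xs: "spine A xs" and ys: "spine B ys"
    and deg: "map (outdegree A) xs = map (outdegree B) ys"
  shows "rtree_iso A B"
proof -
  have A: "rooted_tree A" and B: "rooted_tree B"
    using xs ys by (auto simp: spine_def)
  have len: "length ys = length xs"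
    using deg by (metis length_map)
  have "\<exists>f. bij_betw f (children A (xs ! i)) (children B (ys ! i)) \<and>
      (Suc i < length xs \<longrightarrow> f (xs ! Suc i) = ys ! Suc i)" if i: "i < length xs" for i
  proof -
    have card: "card (children A (xs ! i)) = card (children B (ys ! i))"
      using deg i len by (metis nth_map outdegree_def)
    note fin = finite_children[OF A, of "xs ! i"] finite_children[OF B, of "ys ! i"]
    show ?thesis
    proof (cases "Suc i < length xs")
      case True
      then have "xs ! Suc i \<in> children A (xs ! i)" "ys ! Suc i \<in> children B (ys ! i)"
        using spine_arc[OF xs] spine_arc[OF ys] len by auto
      then show ?thesis using bij_betw_pointed[OF fin card] by metis
    next
      case False
      then show ?thesis using finite_same_card_bij[OF fin card] by blast
    qed
  qed
  then obtain \<beta> where \<beta>: "\<And>i. i < length xs \<Longrightarrow> bij_betw (\<beta> i) (children A (xs ! i)) (children B (ys ! i))"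
      and \<beta>_spine: "\<And>i. Suc i < length xs \<Longrightarrow> \<beta> i (xs ! Suc i) = ys ! Suc i"
    by (metis Suc_lessD)
  have parentA: "\<exists>i<length xs. (xs ! i, v) \<in> arcs A" if "v \<in> verts A" "v \<noteq> root A" for v
    using parent_exists[OF A that] arc_internal[OF A] spine_internals_nth[OF xs] by metis
  have parentB: "\<exists>i<length xs. (ys ! i, v) \<in> arcs B" if "v \<in> verts B" "v \<noteq> root B" for v
    using parent_exists[OF B that] arc_internal[OF B] spine_internals_nth[OF ys] len by metis
  have idx_A: "i = j" if "i < length xs" "j < length xs" "(xs ! i, v) \<in> arcs A" "(xs ! j, v) \<in> arcs A" for i j v
    using rooted_tree_parent_unique[OF A that(3,4)] that xs by (simp add: spine_def nth_eq_iff_index_eq)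
  have idx_B: "i = j" if "i < length xs" "j < length xs" "(ys ! i, v) \<in> arcs B" "(ys ! j, v) \<in> arcs B" for i j v
    using rooted_tree_parent_unique[OF B that(3,4)] that ys len by (simp add: spine_def nth_eq_iff_index_eq)
  \<comment> \<open>The definite description selects the spine position of the parent of
    \<open>v\<close>; only the root has no such position.\<close>
  define \<phi> where "\<phi> v = (if v = root A then root B
      else \<beta> (THE i. i < length xs \<and> (xs ! i, v) \<in> arcs A) v)" for v
  have \<phi>_root: "\<phi> (root A) = root B" by (simp add: \<phi>_def)
  have \<phi>_child: "\<phi> v = \<beta> i v" if i: "i < length xs" "(xs ! i, v) \<in> arcs A" for i v
  proof -
    have "v \<noteq> root A" using i rooted_tree_root_no_parent[OF A] by metis
    moreover have "(THE i. i < length xs \<and> (xs ! i, v) \<in> arcs A) = i"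
      using i idx_A by (intro the_equality) auto
    ultimately show ?thesis by (simp add: \<phi>_def)
  qed
  have \<phi>_arc: "(ys ! i, \<phi> v) \<in> arcs B" if i: "i < length xs" "(xs ! i, v) \<in> arcs A" for i v
    using bij_betwE[OF \<beta>[OF i(1)]] i(2) \<phi>_child[OF i] by simp
  have \<phi>_spine: "\<phi> (xs ! i) = ys ! i" if "i < length xs" for i
  proof (cases i)
    case 0
    then show ?thesis
      using that spine_nth_0[OF xs] spine_nth_0[OF ys] len \<phi>_root by simp
  next
    case (Suc k)
    then show ?thesis
      using that \<phi>_child[of k "xs ! i"] \<beta>_spine[of k] spine_arc[OF xs, of k] by simp
  qed
  have \<phi>_nonroot: "\<phi> v \<noteq> root B" if "v \<in> verts A" "v \<noteq> root A" for v
    using parentA[OF that] \<phi>_arc rooted_tree_root_no_parent[OF B] by metis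
  have inj: "inj_on \<phi> (verts A)"
  proof (rule inj_onI)
    fix v w assume v: "v \<in> verts A" and w: "w \<in> verts A" and eq: "\<phi> v = \<phi> w"
    show "v = w"
    proof (cases "v = root A \<or> w = root A")
      case True
      then show ?thesis using \<phi>_nonroot v w eq \<phi>_root by metis
    next
      case False
      then obtain i j where ij: "i < length xs" "(xs ! i, v) \<in> arcs A" "j < length xs" "(xs ! j, w) \<in> arcs A"
        using parentA v w by metis
      then have "i = j" using \<phi>_arc eq idx_B by metis
      then show ?thesis
        using ij \<phi>_child eq bij_betw_imp_inj_on[OF \<beta>[OF ij(1)]] by (auto simp: inj_on_def)
    qed
  qed
  have "\<phi> ` verts A = verts B"
  proof (intro equalityI subsetI)
    fix w assume "w \<in> \<phi> ` verts A"
    then obtain v where v: "v \<in> verts A" "w = \<phi> v" by auto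
    show "w \<in> verts B"
    proof (cases "v = root A")
      case True
      then show ?thesis using v \<phi>_root B by (simp add: rooted_tree_def)
    next
      case False
      then show ?thesis using v parentA \<phi>_arc rooted_tree_arc_verts[OF B] by metis
    qed
  next
    fix w assume w: "w \<in> verts B"
    show "w \<in> \<phi> ` verts A"
    proof (cases "w = root B")
      case True
      then show ?thesis using \<phi>_root A by (metis imageI rooted_tree_def)
    next
      case False
      then obtain i where i: "i < length xs" "(ys ! i, w) \<in> arcs B"
        using parentB w by metis
      then have "w \<in> \<beta> i ` children A (xs ! i)"
        using bij_betw_imp_surj_on[OF \<beta>[OF i(1)]] by simp
      then obtain v where "(xs ! i, v) \<in> arcs A" "w = \<beta> i v" by auto
      then show ?thesis
        using \<phi>_child i rooted_tree_arc_verts[OF A] by (metis imageI)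
    qed
  qed
  with inj have bij: "bij_betw \<phi> (verts A) (verts B)" by (simp add: bij_betw_def)
  have "(u, v) \<in> arcs A \<longleftrightarrow> (\<phi> u, \<phi> v) \<in> arcs B" if u: "u \<in> verts A" and v: "v \<in> verts A" for u v
  proof
    assume arc: "(u, v) \<in> arcs A"
    then obtain i where i: "i < length xs" "u = xs ! i"
      using arc_internal[OF A] spine_internals_nth[OF xs] by blast
    then show "(\<phi> u, \<phi> v) \<in> arcs B" using \<phi>_spine \<phi>_arc arc by simp
  next
    \<comment> \<open>The argument compares \<open>u\<close> with the actual parent
      \<open>xs ! j\<close> of \<open>v\<close>: the images of both are the parent of
      \<open>\<phi> v\<close>, so injectivity identifies them.\<close>
    assume arc: "(\<phi> u, \<phi> v) \<in> arcs B"
    then have "v \<noteq> root A" using \<phi>_root rooted_tree_root_no_parent[OF B] by metis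
    then obtain j where j: "j < length xs" "(xs ! j, v) \<in> arcs A" using parentA v by blast
    then have "\<phi> u = \<phi> (xs ! j)"
      using \<phi>_arc \<phi>_spine arc rooted_tree_parent_unique[OF B] by metis
    then have "u = xs ! j"
      using inj u j rooted_tree_arc_verts[OF A] by (metis inj_onD)
    then show "(u, v) \<in> arcs A" using j by simp
  qed
  then show ?thesis
    unfolding rtree_iso_def using bij \<phi>_root by blast
qed

text \<open>An isomorphism preserves outdegrees and carries the spine of \<open>A\<close> to a spine
  of \<open>B\<close>, which is \<open>ys\<close> by uniqueness.\<close>

lemma iso_imp_equal_outdegrees:
  assumes xs: "spine A xs" and ys: "spine B ys" and iso: "rtree_iso A B"
  shows "map (outdegree A) xs = map (outdegree B) ys"
proof -
  have A: "rooted_tree A" and B: "rooted_tree B"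
    using xs ys by (auto simp: spine_def)
  obtain \<phi> where bij: "bij_betw \<phi> (verts A) (verts B)" and root: "\<phi> (root A) = root B"
    and arc: "\<And>u v. u \<in> verts A \<Longrightarrow> v \<in> verts A \<Longrightarrow> (u, v) \<in> arcs A \<longleftrightarrow> (\<phi> u, \<phi> v) \<in> arcs B"
    using iso unfolding rtree_iso_def by blast
  have sub: "set xs \<subseteq> verts A" using xs by (auto simp: spine_def internals_def)
  have inj: "inj_on \<phi> (verts A)" and surj: "\<phi> ` verts A = verts B"
    using bij by (auto simp: bij_betw_def)
  have ch: "children B (\<phi> v) = \<phi> ` children A v" if v: "v \<in> verts A" for v
  proof (intro equalityI subsetI)
    fix w assume "w \<in> children B (\<phi> v)"
    then have w: "(\<phi> v, w) \<in> arcs B" by simp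
    then obtain u where u: "u \<in> verts A" "w = \<phi> u"
      using surj rooted_tree_arc_verts[OF B] by (metis imageE)
    then show "w \<in> \<phi> ` children A v" using w arc[OF v u(1)] by simp
  next
    fix w assume "w \<in> \<phi> ` children A v"
    then obtain u where u: "(v, u) \<in> arcs A" "w = \<phi> u" by auto
    then show "w \<in> children B (\<phi> v)"
      using arc[OF v] rooted_tree_arc_verts[OF A] by (metis mem_children)
  qed
  have deg: "outdegree B (\<phi> v) = outdegree A v" if v: "v \<in> verts A" for v
    unfolding outdegree_def ch[OF v]
    using inj rooted_tree_arc_verts[OF A] by (intro card_image) (auto simp: inj_on_def)
  have "internals B = {w \<in> \<phi> ` verts A. outdegree B w \<noteq> 0}"
    unfolding surj by (auto simp: internals_def leaves_def)
  also have "\<dots> = \<phi> ` internals A"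
    using deg by (auto simp: internals_def leaves_def)
  finally have "internals B = \<phi> ` internals A" .
  then have "set (map \<phi> xs) = internals B" using xs by (simp add: spine_def)
  moreover have "distinct (map \<phi> xs)"
    using xs inj sub by (auto simp: spine_def distinct_map intro: inj_on_subset)
  moreover have "successively (\<lambda>u v. (u, v) \<in> arcs B) (map \<phi> xs)"
    unfolding successively_conv_nth
    using spine_arc[OF xs] arc rooted_tree_arc_verts[OF A] by (metis length_map nth_map Suc_lessD)
  moreover have "map \<phi> xs \<noteq> [] \<longrightarrow> hd (map \<phi> xs) = root B"
    using xs root by (auto simp: spine_def hd_map)
  ultimately have "spine B (map \<phi> xs)" using B by (simp add: spine_def)
  then have "ys = map \<phi> xs" using spine_unique ys by blast
  then show ?thesis using deg sub by auto
qed

section \<open>Spanning trees and contractions\<close>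

lemma span_verts_sub:
  assumes "rooted_tree T" "mrca T S \<in> verts T"
  shows "span_verts T S \<subseteq> verts T"
proof
  fix v assume "v \<in> span_verts T S"
  then have "(mrca T S, v) \<in> (arcs T)\<^sup>*" by (simp add: span_verts_def ancestor_def)
  then show "v \<in> verts T"
    using assms by (metis rooted_tree_arc_verts rtranclE)
qed

lemma mrca_eqI:
  assumes T: "rooted_tree T" and "common_ancestor T S a"
    and "\<And>b. common_ancestor T S b \<Longrightarrow> ancestor T b a"
  shows "mrca T S = a"
  unfolding mrca_def
  using assms rooted_tree_antisym[OF T] by (intro the_equality) (auto simp: ancestor_def)

text \<open>The definite description in \<open>mrca\<close> needs a lowest common ancestor to exist.
  The root is a common ancestor, and all common ancestors lie above a fixed \<open>s\<close> in
  \<open>S\<close>, so they form a chain. One with the most ancestors is the lowest.\<close>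

lemma mrca_common_ancestor:
  assumes T: "rooted_tree T" and S: "S \<noteq> {}" "S \<subseteq> verts T"
  shows "common_ancestor T S (mrca T S)"
proof -
  let ?C = "{a. common_ancestor T S a}"
  obtain s where s: "s \<in> S" using S by blast
  have fin: "finite ?C"
    using T by (auto simp: common_ancestor_def rooted_tree_def)
  have "common_ancestor T S (root T)"
    using T S by (auto simp: common_ancestor_def ancestor_def rooted_tree_def)
  then have "?C \<noteq> {}" by blast
  then obtain a where a: "common_ancestor T S a"
    and max: "\<And>b. common_ancestor T S b \<Longrightarrow> card {x. ancestor T x b \<and> x \<in> verts T} \<le> card {x. ancestor T x a \<and> x \<in> verts T}"
    using obtains_MAX[OF fin, of "\<lambda>b. card {x. ancestor T x b \<and> x \<in> verts T}"] fin
    by (smt (verit) Max_ge finite_imageI imageI mem_Collect_eq)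
  have "ancestor T b a" if b: "common_ancestor T S b" for b
  proof (rule ccontr)
    assume nb: "\<not> ancestor T b a"
    then have ab: "(a, b) \<in> (arcs T)\<^sup>*"
      using ancestors_comparable[OF T, of a s b] a b s by (auto simp: common_ancestor_def ancestor_def)
    have "{x. ancestor T x a \<and> x \<in> verts T} \<subset> {x. ancestor T x b \<and> x \<in> verts T}"
      using ab nb b by (auto simp: ancestor_def common_ancestor_def)
    moreover have "finite {x. ancestor T x b \<and> x \<in> verts T}"
      using T by (simp add: rooted_tree_def)
    ultimately show False
      using max[OF b] psubset_card_mono by (metis (no_types, lifting) not_less)
  qed
  with a show ?thesis using mrca_eqI[OF T] by metis
qed

lemma span_tree_simps [simp]:
  "verts (span_tree T S) = span_verts T S" "root (span_tree T S) = mrca T S"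
  "(u, v) \<in> arcs (span_tree T S) \<longleftrightarrow> (u, v) \<in> arcs T \<and> u \<in> span_verts T S \<and> v \<in> span_verts T S"
  by (auto simp: span_tree_def)

lemma rooted_span_tree:
  assumes T: "rooted_tree T" and S: "S \<noteq> {}" "S \<subseteq> verts T"
  shows "rooted_tree (span_tree T S)"
proof -
  let ?a = "mrca T S"
  have ca: "common_ancestor T S ?a" by (rule mrca_common_ancestor[OF assms])
  then have a: "?a \<in> verts T" "?a \<in> span_verts T S"
    using S by (auto simp: common_ancestor_def span_verts_def ancestor_def)
  have "finite (span_verts T S)"
    using span_verts_sub[OF T a(1)] T by (auto simp: rooted_tree_def intro: finite_subset)
  \<comment> \<open>Vertices of the span lie below \<open>?a\<close>, so an arc from one of them
    into \<open>?a\<close> would close a cycle.\<close>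
  moreover have "(u, ?a) \<notin> arcs (span_tree T S)" for u
    using rooted_tree_acyclic[OF T, of ?a]
    by (auto simp: span_verts_def ancestor_def dest: rtrancl_into_trancl1)
  \<comment> \<open>The path from \<open>?a\<close> to \<open>v\<close> stays in the span, since all
    its vertices lie above the leaf \<open>s\<close> below \<open>v\<close>.\<close>
  moreover have "(?a, v) \<in> (arcs (span_tree T S))\<^sup>*" if v: "v \<in> span_verts T S" for v
  proof -
    from v obtain s where s: "s \<in> S" "(v, s) \<in> (arcs T)\<^sup>*" "(?a, v) \<in> (arcs T)\<^sup>*"
      by (auto simp: span_verts_def ancestor_def)
    from s(3,2) show ?thesis
    proof (induction rule: rtrancl_induct)
      case (step y z)
      then have "(y, s) \<in> (arcs T)\<^sup>*" by (meson converse_rtrancl_into_rtrancl)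
      moreover from this step have "(y, z) \<in> arcs (span_tree T S)"
        using s(1) by (auto simp: span_verts_def ancestor_def)
      ultimately show ?case using step.IH by (meson rtrancl.rtrancl_into_rtrancl)
    qed simp
  qed
  ultimately show ?thesis
    unfolding rooted_tree_def using a rooted_tree_parent_unique[OF T] by auto
qed

lemma children_span_tree_sub: "children (span_tree T S) v \<subseteq> children T v"
  by auto

lemma internals_mono:
  assumes "rooted_tree T" "rooted_tree T'" "\<And>v. children T' v \<noteq> {} \<Longrightarrow> children T v \<noteq> {}"
  shows "internals T' \<subseteq> internals T"
  using assms by (auto simp: mem_internals)

lemma span_tree_invariants:
  assumes T: "rooted_tree T" and S: "S \<noteq> {}" "S \<subseteq> verts T"
  shows "internals (span_tree T S) \<subseteq> internals T"
    and "outdegree (span_tree T S) v \<le> outdegree T v"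
    and "internals_linear T \<Longrightarrow> internals_linear (span_tree T S)"
proof -
  show int: "internals (span_tree T S) \<subseteq> internals T"
    using children_span_tree_sub[of T S] by (intro internals_mono T rooted_span_tree[OF assms]) blast
  show "outdegree (span_tree T S) v \<le> outdegree T v"
    unfolding outdegree_def by (intro card_mono finite_children T children_span_tree_sub)
  show "internals_linear (span_tree T S)" if "internals_linear T"
    using that int unfolding internals_linear_def span_tree_simps by blast
qed

text \<open>Only the child set of \<open>f\<close> can gain an element, and there \<open>h\<close>
  takes the place of \<open>g\<close>. All other child sets can only shrink.\<close>

lemma contract_step_invariants:
  assumes T: "rooted_tree T" and step: "contract_step T T'"
  shows "rooted_tree T'"
    and "internals T' \<subseteq> internals T"
    and "outdegree T' v \<le> outdegree T v"
    and "internals_linear T \<Longrightarrow> internals_linear T'"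
proof -
  from step obtain f g h where g: "g \<in> verts T" and fg: "(f, g) \<in> arcs T" and ch: "children T g = {h}"
    and T': "T' = \<lparr>verts = verts T - {g}, arcs = insert (f, h) (arcs T - {(f, g), (g, h)}), root = root T\<rparr>"
    by (auto elim!: contract_step.cases)
  have gh: "(g, h) \<in> arcs T" and gx: "\<And>x. (g, x) \<in> arcs T \<Longrightarrow> x = h"
    using ch by (auto simp: children_def)
  have fx: "\<And>x. (x, g) \<in> arcs T \<Longrightarrow> x = f" and hx: "\<And>x. (x, h) \<in> arcs T \<Longrightarrow> x = g"
    using rooted_tree_parent_unique[OF T] fg gh by blast+
  have ne: "f \<noteq> g" "g \<noteq> h" "g \<noteq> root T" "h \<noteq> root T"
    using rooted_tree_acyclic[OF T] fg gh rooted_tree_root_no_parent[OF T] by blast+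
  have sel: "verts T' = verts T - {g}" "arcs T' = insert (f, h) (arcs T - {(f, g), (g, h)})" "root T' = root T"
    by (simp_all add: T')
  \<comment> \<open>For the deleted vertex \<open>g\<close> the induction carries the reachability
    of its parent \<open>f\<close> instead, from which the new arc leads on to
    \<open>h\<close>.\<close>
  have reach: "(v \<noteq> g \<longrightarrow> (root T, v) \<in> (arcs T')\<^sup>*) \<and> (v = g \<longrightarrow> (root T, f) \<in> (arcs T')\<^sup>*)"
    if "(root T, v) \<in> (arcs T)\<^sup>*" for v
    using that
  proof (induction rule: rtrancl_induct)
    case base
    then show ?case using ne by simp
  next
    case (step y z)
    show ?case
    proof (cases "z = g")
      case True
      then show ?thesis using step fx ne by auto
    next
      case False
      have "(if y = g then f else y, z) \<in> arcs T'"
      proof (cases "y = g")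
        case True
        then have "z = h" using step(2) gx by blast
        then show ?thesis using True by (simp add: sel)
      qed (use step(2) False in \<open>simp add: sel\<close>)
      moreover have "(root T, if y = g then f else y) \<in> (arcs T')\<^sup>*"
        using step(3) by simp
      ultimately have "(root T, z) \<in> (arcs T')\<^sup>*" by (rule rtrancl_into_rtrancl[rotated])
      then show ?thesis using False by simp
    qed
  qed
  show T'_tree: "rooted_tree T'"
    unfolding rooted_tree_def sel
  proof (intro conjI allI impI ballI)
    show "finite (verts T - {g})" using T by (simp add: rooted_tree_def)
    show "root T \<in> verts T - {g}" using T ne by (simp add: rooted_tree_def)
    show "insert (f, h) (arcs T - {(f, g), (g, h)}) \<subseteq> (verts T - {g}) \<times> (verts T - {g})"
    proof
      fix p assume p: "p \<in> insert (f, h) (arcs T - {(f, g), (g, h)})"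
      obtain u v where uv: "p = (u, v)" by (cases p)
      have "(f, h) \<in> (verts T - {g}) \<times> (verts T - {g})"
        using rooted_tree_arc_verts[OF T fg] rooted_tree_arc_verts[OF T gh] ne by blast
      moreover have "u \<noteq> g" "v \<noteq> g" if "(u, v) \<in> arcs T" "(u, v) \<noteq> (f, g)" "(u, v) \<noteq> (g, h)"
        using that fx gx by blast+
      ultimately show "p \<in> (verts T - {g}) \<times> (verts T - {g})"
        using p uv rooted_tree_arc_verts[OF T] by blast
    qed
    show "(u, root T) \<notin> insert (f, h) (arcs T - {(f, g), (g, h)})" for u
      using ne rooted_tree_root_no_parent[OF T] by auto
    show "u = u'" if "(u, v) \<in> insert (f, h) (arcs T - {(f, g), (g, h)})"
      "(u', v) \<in> insert (f, h) (arcs T - {(f, g), (g, h)})" for u u' v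
      using that hx rooted_tree_parent_unique[OF T] by auto
    show "(root T, v) \<in> (insert (f, h) (arcs T - {(f, g), (g, h)}))\<^sup>*" if "v \<in> verts T - {g}" for v
      using reach[OF rooted_tree_reach[OF T, of v]] that by (simp add: sel)
  qed
  have chf: "children T' f = insert h (children T f - {g})"
    using ne by (auto simp: sel)
  have chv: "children T' v \<subseteq> children T v" if "v \<noteq> f" for v
    using that by (auto simp: sel)
  show int: "internals T' \<subseteq> internals T"
    using T T'_tree
  proof (rule internals_mono)
    show "children T v \<noteq> {}" if "children T' v \<noteq> {}" for v
      using that chv[of v] fg by (cases "v = f") auto
  qed
  show "outdegree T' v \<le> outdegree T v"
  proof (cases "v = f")
    case True
    have "card (insert h (children T f - {g})) \<le> Suc (card (children T f - {g}))"
      by (rule card_insert_le_m1) auto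
    also have "\<dots> = card (children T f)"
      using fg finite_children[OF T] by (intro card_Suc_Diff1) auto
    finally show ?thesis using True chf by (simp add: outdegree_def)
  next
    case False
    then show ?thesis
      unfolding outdegree_def by (intro card_mono finite_children T chv)
  qed
  show "internals_linear T'" if lin: "internals_linear T"
    unfolding internals_linear_def
  proof (intro allI impI)
    fix u v w
    assume uv: "(u, v) \<in> arcs T'" and uw: "(u, w) \<in> arcs T'"
      and "v \<in> internals T'" "w \<in> internals T'"
    then have v: "v \<in> internals T" and w: "w \<in> internals T" using int by auto
    have gi: "g \<in> internals T" using arc_internal[OF T gh] .
    \<comment> \<open>Since \<open>g\<close> has a child, linearity makes it the only internal child
      of \<open>f\<close> in \<open>T\<close>; once it is gone, only \<open>h\<close> can be
      internal.\<close>
    have *: "x = h" if "(f, x) \<in> arcs T'" "x \<in> internals T" for x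
      using that lin fg gi unfolding internals_linear_def by (auto simp: sel)
    show "v = w"
    proof (cases "u = f")
      case True
      then show ?thesis using * uv uw v w by blast
    next
      case False
      then show ?thesis
        using lin uv uw v w unfolding internals_linear_def by (auto simp: sel)
    qed
  qed
qed

text \<open>Together with \<open>spine_exists\<close> this gives every leaf-induced subtree of such
  a tree a spine, with length and outdegrees bounded by those of \<open>T\<close>.\<close>

lemma induces_invariants:
  assumes T: "rooted_tree T" and lin: "internals_linear T" and S: "S \<noteq> {}" "S \<subseteq> leaves T"
    and ind: "induces T S T'"
  shows "rooted_tree T' \<and> internals_linear T' \<and> internals T' \<subseteq> internals T \<and>
    (\<forall>v. outdegree T' v \<le> outdegree T v)"
proof -
  have "S \<subseteq> verts T" using S by (auto simp: leaves_def)
  note span = rooted_span_tree[OF T S(1) this] span_tree_invariants[OF T S(1) this]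
  have "contract_step\<^sup>*\<^sup>* (span_tree T S) T'" using ind by (simp add: induces_def)
  then show ?thesis
  proof (induction rule: rtranclp_induct)
    case base
    then show ?case using span lin by blast
  next
    case (step A B)
    then show ?case
      using contract_step_invariants[of A B] by (meson order_trans)
  qed
qed

section \<open>Number of internal vertices\<close>

text \<open>Every vertex except the root is the head of exactly one arc; the arcs are then counted
  by their tails.\<close>

lemma card_verts_rooted_tree:
  assumes T: "rooted_tree T"
  shows "card (verts T) = Suc (\<Sum>v\<in>internals T. outdegree T v)"
proof -
  have arcs: "arcs T = (SIGMA v:internals T. children T v)"
    using arc_internal[OF T] by auto
  have "bij_betw snd (arcs T) (verts T - {root T})"
    unfolding bij_betw_def
  proof
    show "inj_on snd (arcs T)"
      using rooted_tree_parent_unique[OF T] by (auto simp: inj_on_def)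
    show "snd ` arcs T = verts T - {root T}"
    proof (intro equalityI subsetI)
      show "v \<in> verts T - {root T}" if "v \<in> snd ` arcs T" for v
        using that rooted_tree_arc_verts[OF T] rooted_tree_root_no_parent[OF T] by auto
      show "v \<in> snd ` arcs T" if "v \<in> verts T - {root T}" for v
        using that parent_exists[OF T, of v] by (metis DiffE insertI1 snd_conv imageI)
    qed
  qed
  then have "card (verts T - {root T}) = card (arcs T)"
    by (simp add: bij_betw_same_card)
  also have "\<dots> = (\<Sum>v\<in>internals T. outdegree T v)"
    unfolding outdegree_def using arcs finite_internals[OF T] finite_children[OF T]
    by (metis card_SigmaI)
  finally show ?thesis
    using T by (metis card_Suc_Diff1 rooted_tree_def)
qed

text \<open>Recovers the height from the number of leaves. With \<open>k\<close> internal vertices,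
  counting vertices in two ways gives \<open>1 + k * d = (1 + h * (d - 1)) + k\<close>, hence
  \<open>k = h\<close>.\<close>

lemma card_internals_regular:
  assumes T: "rooted_tree T" and deg: "\<And>v. v \<in> verts T \<Longrightarrow> outdegree T v \<in> {0, d}"
    and leaves: "card (leaves T) = 1 + h * (d - 1)" and d: "d \<ge> 2"
  shows "card (internals T) = h"
proof -
  have "outdegree T v = d" if "v \<in> internals T" for v
    using that deg[of v] by (auto simp: internals_def leaves_def)
  then have "card (verts T) = Suc (card (internals T) * d)"
    using card_verts_rooted_tree[OF T] by simp
  moreover have "card (verts T) = card (leaves T) + card (internals T)"
  proof -
    have "leaves T \<subseteq> verts T" "finite (verts T)" using T by (auto simp: leaves_def rooted_tree_def)
    then show ?thesis
      unfolding internals_def by (simp add: card_Diff_subset finite_subset card_mono)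
  qed
  ultimately have "card (internals T) * d = h * (d - 1) + card (internals T)"
    using leaves by simp
  moreover obtain e where "d = Suc (Suc e)" using d by (metis add_2_eq_Suc le_Suc_ex)
  ultimately have "card (internals T) * Suc e = h * Suc e" by simp
  then show ?thesis by (simp only: mult_cancel2) simp
qed

section \<open>Realizing outdegree lists\<close>

text \<open>A common ancestor not above \<open>a\<close> would lie at or below some child
  \<open>x\<close> of \<open>a\<close>. Then \<open>x\<close> is above both \<open>s\<close> and
  \<open>s'\<close>, and since siblings are incomparable it would equal both \<open>c\<close> and
  \<open>c'\<close>.\<close>

lemma mrca_branching:
  assumes T: "rooted_tree T" and ca: "common_ancestor T S a"
    and c: "(a, c) \<in> arcs T" "(a, c') \<in> arcs T" "c \<noteq> c'"
    and s: "s \<in> S" "(c, s) \<in> (arcs T)\<^sup>*" "s' \<in> S" "(c', s') \<in> (arcs T)\<^sup>*"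
  shows "mrca T S = a"
proof (rule mrca_eqI[OF T ca])
  fix b assume b: "common_ancestor T S b"
  have bs: "(b, s) \<in> (arcs T)\<^sup>*" "(b, s') \<in> (arcs T)\<^sup>*" and as: "(a, s) \<in> (arcs T)\<^sup>*"
    using b ca s by (auto simp: common_ancestor_def ancestor_def)
  show "ancestor T b a"
  proof (rule ccontr)
    assume nb: "\<not> ancestor T b a"
    then have "(a, b) \<in> (arcs T)\<^sup>*" "a \<noteq> b"
      using ancestors_comparable[OF T as bs(1)] by (auto simp: ancestor_def)
    then obtain x where x: "(a, x) \<in> arcs T" "(x, b) \<in> (arcs T)\<^sup>*"
      by (metis converse_rtranclE)
    have same: "x = y" if "(a, y) \<in> arcs T" "(y, t) \<in> (arcs T)\<^sup>*" "(b, t) \<in> (arcs T)\<^sup>*" for y t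
    proof -
      have "(x, t) \<in> (arcs T)\<^sup>*" using x(2) that(3) by (rule rtrancl_trans)
      then show ?thesis
        using ancestors_comparable[OF T _ that(2)] siblings_incomparable[OF T] x(1) that(1) by metis
    qed
    show False
      using same[OF c(1) s(2) bs(1)] same[OF c(2) s(4) bs(2)] c(3) by simp
  qed
qed

text \<open>Realizes the empty outdegree list by the one-vertex tree.\<close>

lemma leaf_span_tree:
  assumes T: "rooted_tree T" and s: "s \<in> leaves T"
  shows "span_tree T {s} \<in> leaf_induced_subtrees T" and "spine (span_tree T {s}) []"
proof -
  have sv: "s \<in> verts T" using s by (simp add: leaves_def)
  have "mrca T {s} = s"
    using sv by (intro mrca_eqI[OF T]) (auto simp: common_ancestor_def ancestor_def)
  then have "span_verts T {s} = {s}"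
    using leaf_no_child[OF T s] by (auto simp: span_verts_def ancestor_def elim: converse_rtranclE)
  then have ch: "children (span_tree T {s}) v = {}" for v
    using leaf_no_child[OF T s] by (auto simp: children_def)
  have tree: "rooted_tree (span_tree T {s})"
    using rooted_span_tree[OF T, of "{s}"] sv by simp
  then have "internals (span_tree T {s}) = {}"
    using ch by (auto simp: mem_internals)
  then show "spine (span_tree T {s}) []"
    using tree by (simp add: spine_def)
  have "induces T {s} (span_tree T {s})"
    unfolding induces_def outdegree_def ch by simp
  then show "span_tree T {s} \<in> leaf_induced_subtrees T"
    unfolding leaf_induced_subtrees_def using s by blast
qed

text \<open>The internal vertices of the witness are the last \<open>length ks\<close> spine vertices, so that no
  contraction is needed.\<close>

lemma outdegrees_realized_nonempty:
  assumes sp: "spine T xs" and deg: "\<And>v. v \<in> internals T \<Longrightarrow> outdegree T v = d"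
    and ks: "set ks \<subseteq> {2..d}" "length ks \<le> length xs" "ks \<noteq> []"
  obtains T' ys where "T' \<in> leaf_induced_subtrees T" "spine T' ys" "map (outdegree T') ys = ks"
proof -
  have T: "rooted_tree T" using sp by (simp add: spine_def)
  define m where "m = length ks"
  define k where "k = length xs - m"
  define ys where "ys = drop k xs"
  have m: "0 < m" using ks by (simp add: m_def)
  have len: "length ys = m" using ks by (simp add: ys_def k_def m_def)
  have nth: "ys ! i = xs ! (k + i)" for i
    using ks by (simp add: ys_def k_def m_def)
  have bound: "k + i < length xs" if "i < m" for i
    using that ks by (simp add: k_def m_def)
  have dist: "distinct ys" using sp by (simp add: ys_def spine_def)
  have internal: "ys ! i \<in> internals T" if "i < m" for i
    using spine_internals_nth[OF sp] bound[OF that] nth by metis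
  have arc: "(ys ! i, ys ! Suc i) \<in> arcs T" if "Suc i < m" for i
    using spine_arc[OF sp, of "k + i"] bound[OF that] nth by simp
  have next_internal: "Suc i < m \<and> v = ys ! Suc i"
    if "i < m" "(ys ! i, v) \<in> arcs T" "v \<in> internals T" for i v
  proof -
    have "Suc (k + i) < length xs" "v = xs ! Suc (k + i)"
      using spine_internal_child[OF sp bound[OF that(1)], of v] that(2,3) by (simp_all add: nth)
    then show ?thesis using ks by (simp add: nth k_def m_def)
  qed
  have ks_nth: "2 \<le> ks ! i" "ks ! i \<le> d" if "i < m" for i
    using ks that by (metis atLeastAtMost_iff m_def nth_mem subsetD)+
  \<comment> \<open>\<open>C i\<close> is to be the child set of \<open>ys ! i\<close> in the
    witness. It must contain the next spine vertex, if there is one, to keep the witness connected;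
    the bounds \<open>2\<close> and \<open>d\<close> on \<open>ks ! i\<close> leave enough children
    for the rest.\<close>
  have "\<exists>C. C \<subseteq> children T (ys ! i) \<and> card C = ks ! i \<and> (Suc i < m \<longrightarrow> ys ! Suc i \<in> C)"
    if i: "i < m" for i
  proof -
    let ?X = "children T (ys ! i)"
    have cX: "card ?X = d" using deg[OF internal[OF i]] by (simp add: outdegree_def)
    have fin: "finite ?X" by (rule finite_children[OF T])
    show ?thesis
    proof (cases "Suc i < m")
      case True
      then have mem: "ys ! Suc i \<in> ?X" using arc by simp
      then have "ks ! i - 1 \<le> card (?X - {ys ! Suc i})" using cX ks_nth[OF i] fin by simp
      then obtain C where C: "C \<subseteq> ?X - {ys ! Suc i}" "card C = ks ! i - 1" "finite C"
        by (metis obtain_subset_with_card_n)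
      then have "ys ! Suc i \<notin> C" by blast
      then have "card (insert (ys ! Suc i) C) = ks ! i" using C ks_nth[OF i] by simp
      then show ?thesis using C mem by (intro exI[of _ "insert (ys ! Suc i) C"]) auto
    next
      case False
      then show ?thesis using cX ks_nth[OF i] by (metis obtain_subset_with_card_n)
    qed
  qed
  then obtain C where C: "\<And>i. i < m \<Longrightarrow> C i \<subseteq> children T (ys ! i)"
      and card_C: "\<And>i. i < m \<Longrightarrow> card (C i) = ks ! i"
      and spine_C: "\<And>i. Suc i < m \<Longrightarrow> ys ! Suc i \<in> C i"
    by (metis Suc_lessD)
  have C_arc: "(ys ! i, c) \<in> arcs T" if "i < m" "c \<in> C i" for i c
    using C that by fastforce
  have C_next: "c \<in> leaves T \<or> (Suc i < m \<and> c = ys ! Suc i)" if "i < m" "c \<in> C i" for i c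
    using leaf_or_internal[of c T] next_internal[OF that(1) C_arc[OF that]]
      rooted_tree_arc_verts[OF T C_arc[OF that]] by blast
  \<comment> \<open>Only the chosen leaves are put into \<open>S\<close>; the chosen spine vertices
    return in the span as ancestors of leaves further down.\<close>
  define S where "S = {c \<in> leaves T. \<exists>i<m. c \<in> C i}"
  define a where "a = ys ! 0"
  \<comment> \<open>Induction from the lower end of the spine: a chosen child is itself in
    \<open>S\<close> or is the next spine vertex.\<close>
  have below: "\<exists>s\<in>S. (ys ! i, s) \<in> (arcs T)\<^sup>*" if "i < m" for i
    using that
  proof (induction "m - i" arbitrary: i)
    case (Suc x)
    have "C i \<noteq> {}" using card_C[OF Suc.prems] ks_nth[OF Suc.prems] by auto
    then obtain c where c: "c \<in> C i" by blast
    show ?case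
    proof (cases "c \<in> leaves T")
      case True
      then show ?thesis using c Suc.prems C_arc[OF Suc.prems c] by (auto simp: S_def)
    next
      case False
      then have n: "Suc i < m" "c = ys ! Suc i" using C_next[OF Suc.prems c] by auto
      then obtain s where "s \<in> S" "(c, s) \<in> (arcs T)\<^sup>*"
        using Suc.hyps by (metis Suc_diff_Suc Suc.prems Suc_inject)
      then show ?thesis
        using C_arc[OF Suc.prems c] by (meson converse_rtrancl_into_rtrancl)
    qed
  qed simp
  have C_below: "\<exists>s\<in>S. (c, s) \<in> (arcs T)\<^sup>*" if "i < m" "c \<in> C i" for i c
    using C_next[OF that] below that by (auto simp: S_def)
  have a_spine: "(a, ys ! i) \<in> (arcs T)\<^sup>*" if "i < m" for i
    using that
  proof (induction i)
    case (Suc i)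
    then show ?case using arc[OF Suc.prems] by (meson Suc_lessD rtrancl.rtrancl_into_rtrancl)
  qed (simp add: a_def)
  have a_C: "(a, c) \<in> (arcs T)\<^sup>*" if "i < m" "c \<in> C i" for i c
    using a_spine[OF that(1)] C_arc[OF that] by (rule rtrancl_into_rtrancl)
  have ca: "common_ancestor T S a"
    using internal[OF m] a_C by (auto simp: common_ancestor_def ancestor_def a_def S_def internals_def)
  \<comment> \<open>The first entry of \<open>ks\<close> is at least \<open>2\<close>, so
    \<open>a\<close> has two chosen children, each with a leaf of \<open>S\<close> at or below it.
    This makes \<open>a\<close> the most recent common ancestor.\<close>
  have "\<not> card (C 0) \<le> Suc 0" using card_C[OF m] ks_nth[OF m] by simp
  moreover have "finite (C 0)" using C[OF m] finite_children[OF T] by (rule finite_subset)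
  ultimately obtain c c' where c: "c \<in> C 0" "c' \<in> C 0" "c \<noteq> c'"
    using card_le_Suc0_iff_eq by blast
  obtain s s' where s: "s \<in> S" "(c, s) \<in> (arcs T)\<^sup>*" "s' \<in> S" "(c', s') \<in> (arcs T)\<^sup>*"
    using C_below[OF m] c by blast
  have mrca: "mrca T S = a"
    using mrca_branching[OF T ca _ _ c(3) s] C_arc[OF m] c by (simp add: a_def)
  have S: "S \<noteq> {}" "S \<subseteq> leaves T" "S \<subseteq> verts T"
    using s by (auto simp: S_def leaves_def)
  have between: "v \<in> set ys" if "j < m" "(v, ys ! j) \<in> (arcs T)\<^sup>*" "(a, v) \<in> (arcs T)\<^sup>*" for v j
    using that
  proof (induction j)
    case 0
    then have "v = ys ! 0" using rooted_tree_antisym[OF T] by (simp add: a_def)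
    then show ?case using m len by simp
  next
    case (Suc j)
    show ?case
    proof (cases "v = ys ! Suc j")
      case True
      then show ?thesis using Suc.prems len by simp
    next
      case False
      then obtain z where "(v, z) \<in> (arcs T)\<^sup>*" "(z, ys ! Suc j) \<in> arcs T"
        using Suc.prems(2) by (metis rtranclE)
      then have "(v, ys ! j) \<in> (arcs T)\<^sup>*"
        using arc[OF Suc.prems(1)] rooted_tree_parent_unique[OF T] by metis
      then show ?thesis using Suc by simp
    qed
  qed
  \<comment> \<open>The span contains nothing but its root and the chosen children, so the outdegree
    of \<open>ys ! i\<close> in it is the size of \<open>C i\<close>.\<close>
  have span: "v \<in> span_verts T S \<longleftrightarrow> v = a \<or> (\<exists>i<m. v \<in> C i)" for v
  proof
    assume "v \<in> span_verts T S"
    then obtain t where t: "t \<in> S" "(v, t) \<in> (arcs T)\<^sup>*" and av: "(a, v) \<in> (arcs T)\<^sup>*"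
      by (auto simp: span_verts_def ancestor_def mrca)
    from t(1) obtain j where j: "j < m" "t \<in> C j" by (auto simp: S_def)
    show "v = a \<or> (\<exists>i<m. v \<in> C i)"
    proof (cases "v = t")
      case False
      then obtain z where "(v, z) \<in> (arcs T)\<^sup>*" "(z, t) \<in> arcs T"
        using t(2) by (metis rtranclE)
      then have "(v, ys ! j) \<in> (arcs T)\<^sup>*"
        using C_arc[OF j] rooted_tree_parent_unique[OF T] by metis
      then have "v \<in> set ys" using between j av by blast
      then obtain i where i: "i < m" "v = ys ! i" using len by (auto simp: in_set_conv_nth)
      show ?thesis
        using i spine_C by (cases i) (auto simp: a_def dest: Suc_lessD)
    qed (use j in blast)
  next
    assume "v = a \<or> (\<exists>i<m. v \<in> C i)"
    then show "v \<in> span_verts T S"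
      using below[OF m] C_below a_C by (auto simp: span_verts_def ancestor_def mrca a_def)
  qed
  let ?T = "span_tree T S"
  have tree: "rooted_tree ?T" by (rule rooted_span_tree[OF T S(1,3)])
  have span_ys: "ys ! i \<in> span_verts T S" if "i < m" for i
    using that spine_C unfolding span by (cases i) (auto simp: a_def dest: Suc_lessD)
  have ch: "children ?T (ys ! i) = C i" if i: "i < m" for i
  proof (intro equalityI subsetI)
    fix w assume "w \<in> children ?T (ys ! i)"
    then have w: "(ys ! i, w) \<in> arcs ?T" by simp
    then have "w \<noteq> a" using rooted_tree_root_no_parent[OF tree] mrca by auto
    then obtain j where j: "j < m" "w \<in> C j" using w span by auto
    then have "ys ! j = ys ! i"
      using rooted_tree_parent_unique[OF T C_arc[OF j], of "ys ! i"] w by simp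
    then show "w \<in> C i" using dist i j len by (simp add: nth_eq_iff_index_eq)
  next
    fix w assume "w \<in> C i"
    then show "w \<in> children ?T (ys ! i)"
      using C_arc[OF i] span_ys[OF i] span i by auto
  qed
  have deg_ys: "outdegree ?T (ys ! i) = ks ! i" if "i < m" for i
    using ch[OF that] card_C[OF that] by (simp add: outdegree_def)
  have int: "internals ?T = set ys"
  proof (intro equalityI subsetI)
    fix v assume v: "v \<in> internals ?T"
    then have "v \<in> internals T" using span_tree_invariants(1)[OF T S(1,3)] by blast
    moreover have "v = a \<or> (\<exists>i<m. v \<in> C i)" using v span by (simp add: internals_def)
    ultimately obtain j where "j < m" "v = ys ! j"
      using next_internal C_arc m unfolding a_def by metis
    then show "v \<in> set ys" using len by simp
  next
    fix v assume "v \<in> set ys"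
    then obtain i where i: "i < m" "v = ys ! i" using len by (auto simp: in_set_conv_nth)
    moreover have "C i \<noteq> {}" using card_C[OF i(1)] ks_nth[OF i(1)] by auto
    ultimately show "v \<in> internals ?T" using ch mem_internals[OF tree] by blast
  qed
  have "successively (\<lambda>u v. (u, v) \<in> arcs ?T) ys"
    unfolding successively_conv_nth len using arc span_ys by (auto dest: Suc_lessD)
  moreover have "hd ys = root ?T"
    using m len mrca by (simp add: a_def hd_conv_nth flip: length_greater_0_conv)
  ultimately have spine: "spine ?T ys"
    using tree dist int by (simp add: spine_def)
  \<comment> \<open>All outdegrees are \<open>0\<close> or entries of \<open>ks\<close>, so the
    spanning tree is already induced, after zero contractions.\<close>
  have "outdegree ?T v \<noteq> 1" if "v \<in> verts ?T" for v
  proof (cases "v \<in> internals ?T")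
    case True
    then obtain i where "i < m" "v = ys ! i" using int len by (auto simp: in_set_conv_nth)
    then show ?thesis using deg_ys ks_nth by fastforce
  next
    case False
    then show ?thesis using that by (simp add: internals_def leaves_def)
  qed
  then have "?T \<in> leaf_induced_subtrees T"
    unfolding leaf_induced_subtrees_def induces_def using S by blast
  moreover have "map (outdegree ?T) ys = ks"
    using deg_ys len by (intro nth_equalityI) (auto simp: m_def)
  ultimately show ?thesis using spine that by blast
qed

section \<open>Isomorphism classes\<close>

text \<open>The complete isomorphism invariant of trees with a spine; the definite description is
  justified by \<open>spine_unique\<close>.\<close>

definition spine_outdegrees :: "'v rtree \<Rightarrow> nat list" where
  "spine_outdegrees T = map (outdegree T) (THE xs. spine T xs)"

lemma spine_outdegrees_eq: "spine T xs \<Longrightarrow> spine_outdegrees T = map (outdegree T) xs"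
  unfolding spine_outdegrees_def using spine_unique by (metis the_equality)

lemma rtree_iso_iff_spine_outdegrees:
  assumes "spine A xs" "spine B ys"
  shows "rtree_iso A B \<longleftrightarrow> spine_outdegrees A = spine_outdegrees B"
  using equal_outdegrees_imp_iso[OF assms] iso_imp_equal_outdegrees[OF assms] assms
  by (auto simp: spine_outdegrees_eq)

text \<open>The classes in the quotient contain arbitrary records of the type, possibly without a
  spine, so comparing outdegree lists does not suffice to show two classes equal.\<close>

lemma rtree_iso_trans:
  assumes "rtree_iso A B" "rtree_iso B C"
  shows "rtree_iso A C"
proof -
  obtain \<phi> where \<phi>: "bij_betw \<phi> (verts A) (verts B)" "\<phi> (root A) = root B"
    "\<forall>u\<in>verts A. \<forall>v\<in>verts A. (u, v) \<in> arcs A \<longleftrightarrow> (\<phi> u, \<phi> v) \<in> arcs B"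
    using assms(1) unfolding rtree_iso_def by blast
  obtain \<psi> where \<psi>: "bij_betw \<psi> (verts B) (verts C)" "\<psi> (root B) = root C"
    "\<forall>u\<in>verts B. \<forall>v\<in>verts B. (u, v) \<in> arcs B \<longleftrightarrow> (\<psi> u, \<psi> v) \<in> arcs C"
    using assms(2) unfolding rtree_iso_def by blast
  show ?thesis
    unfolding rtree_iso_def
    using bij_betw_trans[OF \<phi>(1) \<psi>(1)] \<phi> \<psi> bij_betwE[OF \<phi>(1)]
    by (intro exI[of _ "\<psi> \<circ> \<phi>"]) simp
qed

lemma card_iso_classes:
  fixes Q :: "'v rtree set"
  assumes sp: "\<And>A. A \<in> Q \<Longrightarrow> \<exists>xs. spine A xs"
  shows "card (Q // {(A, B). rtree_iso A B}) = card (spine_outdegrees ` Q)"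
proof -
  let ?R = "{(A :: 'v rtree, B :: 'v rtree). rtree_iso A B}"
  have iff: "rtree_iso A B \<longleftrightarrow> spine_outdegrees A = spine_outdegrees B" if "A \<in> Q" "B \<in> Q" for A B
    using sp that rtree_iso_iff_spine_outdegrees by metis
  have classes_eq: "?R `` {A} = ?R `` {B} \<longleftrightarrow> spine_outdegrees A = spine_outdegrees B" if AB: "A \<in> Q" "B \<in> Q" for A B
  proof
    assume "?R `` {A} = ?R `` {B}"
    then have "rtree_iso A B" using iff[of B B] AB by blast
    then show "spine_outdegrees A = spine_outdegrees B" using iff AB by blast
  next
    assume "spine_outdegrees A = spine_outdegrees B"
    then have "rtree_iso A B" "rtree_iso B A" using iff AB by auto
    then show "?R `` {A} = ?R `` {B}" using rtree_iso_trans by blast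
  qed
  \<comment> \<open>The representative is taken from \<open>Q\<close>, because a class may also
    contain trees outside \<open>Q\<close>.\<close>
  let ?g = "\<lambda>X. spine_outdegrees (SOME A. A \<in> Q \<and> X = ?R `` {A})"
  have g: "?g (?R `` {A}) = spine_outdegrees A" if "A \<in> Q" for A
  proof -
    define B where "B = (SOME B. B \<in> Q \<and> ?R `` {A} = ?R `` {B})"
    have B: "B \<in> Q \<and> ?R `` {A} = ?R `` {B}"
      unfolding B_def by (rule someI[of _ A]) (use that in simp)
    then have "spine_outdegrees A = spine_outdegrees B"
      using classes_eq[OF that conjunct1[OF B]] by blast
    then show ?thesis by (simp only: B_def)
  qed
  have Q: "Q // ?R = (\<lambda>A. ?R `` {A}) ` Q" by (auto simp: quotient_def)
  have inj: "inj_on ?g (Q // ?R)"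
  proof (rule inj_onI)
    fix X Y assume X: "X \<in> Q // ?R" and Y: "Y \<in> Q // ?R" and eq: "?g X = ?g Y"
    obtain A where A: "A \<in> Q" "X = ?R `` {A}" using X unfolding Q by blast
    obtain B where B: "B \<in> Q" "Y = ?R `` {B}" using Y unfolding Q by blast
    have "spine_outdegrees A = spine_outdegrees B"
      using eq unfolding A(2) B(2) g[OF A(1)] g[OF B(1)] .
    then show "X = Y" using classes_eq[OF A(1) B(1)] A(2) B(2) by blast
  qed
  have img: "?g ` (Q // ?R) = spine_outdegrees ` Q"
    unfolding Q image_image by (rule image_cong[OF refl g])
  show ?thesis
    using card_image[OF inj] unfolding img by (rule sym)
qed

theorem theorem2p2:
  fixes T :: "'v rtree" and d n h :: nat
  assumes "d \<ge> 3" and "h \<ge> 1" and "n = 1 + h * (d - 1)"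
    and "caterpillar d n T"
  shows "real (num_leaf_induced T) =
    ((real d - 1) powr ((real n + real d - 2) / (real d - 1)) - 1) / (real d - 2)"
proof -
  have T: "rooted_tree T" and leaves: "card (leaves T) = n"
    and deg: "\<And>v. v \<in> verts T \<Longrightarrow> outdegree T v \<in> {0, d}"
    using assms(4) by (auto simp: caterpillar_def)
  obtain xs where xs: "spine T xs"
    using assms(4) by (auto simp: caterpillar_def spine_def)
  have h: "card (internals T) = h"
    using card_internals_regular[OF T deg] leaves assms by simp
  then have len: "length xs = h"
    using xs by (metis distinct_card spine_def)
  have deg_int: "outdegree T v = d" if "v \<in> internals T" for v
    using that deg[of v] by (auto simp: internals_def leaves_def)
  let ?Q = "leaf_induced_subtrees T" and ?K = "{ks. set ks \<subseteq> {2..d} \<and> length ks \<le> h}"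
  have sub: "\<exists>ys. spine A ys \<and> spine_outdegrees A \<in> ?K" if A: "A \<in> ?Q" for A
  proof -
    obtain S where S: "S \<noteq> {}" "S \<subseteq> leaves T" "induces T S A"
      using A by (auto simp: leaf_induced_subtrees_def)
    have inv: "rooted_tree A" "internals_linear A" "internals A \<subseteq> internals T"
      "\<And>v. outdegree A v \<le> outdegree T v"
      using induces_invariants[OF T spine_imp_linear[OF xs] S] by auto
    obtain ys where ys: "spine A ys" using spine_exists[OF inv(1,2)] .
    have "outdegree A v \<in> {2..d}" if v: "v \<in> internals A" for v
    proof -
      have "outdegree A v \<noteq> 0" "v \<in> verts A" using v by (auto simp: internals_def leaves_def)
      \<comment> \<open>Full contraction, required by \<open>induces\<close>, is what raises the
        lower bound on the entries to \<open>2\<close>.\<close>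
      moreover have "outdegree A v \<noteq> 1" using S(3) calculation by (auto simp: induces_def)
      moreover have "outdegree A v \<le> d" using inv(3,4) deg_int v by (metis subsetD)
      ultimately show ?thesis by simp
    qed
    moreover have "length ys \<le> h"
      using card_mono[OF finite_internals[OF T] inv(3)] h ys by (metis distinct_card spine_def)
    moreover have "set ys = internals A" using ys by (simp add: spine_def)
    ultimately have "map (outdegree A) ys \<in> ?K" by auto
    then show ?thesis using ys by (metis spine_outdegrees_eq)
  qed
  have "spine_outdegrees ` ?Q = ?K"
  proof (intro equalityI subsetI)
    fix ks assume ks: "ks \<in> ?K"
    show "ks \<in> spine_outdegrees ` ?Q"
    proof (cases "ks = []")
      case True
      have "leaves T \<noteq> {}" using leaves assms by auto
      then obtain s where "s \<in> leaves T" by blast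
      from leaf_span_tree[OF T this] show ?thesis
        using True spine_outdegrees_eq by (metis image_eqI list.simps(8))
    next
      case False
      then obtain A ys where "A \<in> ?Q" "spine A ys" "map (outdegree A) ys = ks"
        using outdegrees_realized_nonempty[OF xs deg_int, of ks] ks len by blast
      then show ?thesis using spine_outdegrees_eq by (metis image_eqI)
    qed
  qed (use sub in auto)
  moreover have "num_leaf_induced T = card (spine_outdegrees ` ?Q)"
    unfolding num_leaf_induced_def using sub by (intro card_iso_classes) blast
  \<comment> \<open>The base \<open>d - 1\<close> is the size of the alphabet
    \<open>{2..d}\<close>.\<close>
  ultimately have "num_leaf_induced T = (\<Sum>i\<le>h. (d - 1) ^ i)"
    using card_lists_length_le[of "{2..d}" h] by simp
  then have "real (num_leaf_induced T) = (\<Sum>i<Suc h. (real d - 1) ^ i)"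
    using assms(1) by (simp add: of_nat_diff lessThan_Suc_atMost)
  \<comment> \<open>The ratio \<open>d - 1\<close> differs from \<open>1\<close> because
    \<open>d\<close> is at least \<open>3\<close>.\<close>
  also have "\<dots> = ((real d - 1) ^ Suc h - 1) / (real d - 2)"
    using assms(1) by (subst geometric_sum) auto
  also have "(real d - 1) ^ Suc h = (real d - 1) powr real (Suc h)"
    using assms(1) by (subst powr_realpow) auto
  \<comment> \<open>Substituting \<open>n = 1 + h * (d - 1)\<close> gives
    \<open>n + d - 2 = (h + 1) * (d - 1)\<close>.\<close>
  also have "real (Suc h) = (real n + real d - 2) / (real d - 1)"
    using assms(1,3) by (simp add: of_nat_diff field_simps)
  finally show ?thesis .
qed

end
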